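(* Let $(A,\succ)$ be a Zinbiel algebra with a derivation $D$. Define $$a\lhd b:=D(b)\succ a,\qquad a\rhd b:=a\succ D(b),\qquad a,b\in A.$$ Then $(A,\lhd,\rhd,\succ)$ is a pre-differential Novikov-Poisson algebra.
   Context: Let $\mathbf k$ be a field of characteristic $0$; vector spaces are over $\mathbf k$ and assumed finite-dimensional. A Zinbiel algebra $(A,\succ)$ is a vector space with a bilinear operation satisfying $a\succ(b\succ c)=(b\succ a+a\succ b)\succ c$. A derivation is a linear map $D:A\to A$ with $D(a\succ b)=D(a)\succ b+a\succ D(b)$. A pre-Novikov algebra $(A,\lhd,\rhd)$ is a vector space with two bilinear operations such that for all $a,b,c\in A$: $a\rhd(b\rhd c)=(a\rhd b+a\lhd b)\rhd c+b\rhd(a\rhd c)-(b\rhd a+b\lhd a)\rhd c$; $a\rhd(b\lhd c)=(a\rhd b)\lhd c+b\lhd(a\lhd c+a\rhd c)-(b\lhd a)\lhd c$; $(a\lhd b+a\rhd b)\rhd c=(a\rhd c)\lhd b$; $(a\lhd b)\lhd c=(a\lhd c)\lhd b$. A pre-differential Novikov-Poisson algebra $(A,\lhd,\rhd,\succ)$ is such that $(A,\lhd,\rhd)$ is a pre-Novikov algebra, $(A,\succ)$ is a Zinbiel algebra, and for all $a,b,c\in A$: $(a\succ b+b\succ a)\rhd c=a\succ(b\rhd c)$; $(a\succ c)\lhd b=a\succ(c\lhd b)=(a\lhd b+a\rhd b)\succ c$; $a\rhd(b\succ c)=(a\lhd b+a\rhd b)\succ c+b\succ(a\rhd c)$; $c\lhd(a\succ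 b+b\succ a)=b\succ(c\lhd a)+a\succ(c\lhd b)$. *)

theory Defs
  imports Complex_Main
begin

text \<open>
  The ground field is the type \<open>'k :: field_char_0\<close>; a vector space over it is a whole type
  \<open>'a :: ab_group_add\<close> together with a scalar multiplication \<open>scale\<close>.
  All vector spaces are finite-dimensional. The library locale
  \<open>finite_dimensional_vector_space\<close> carries a basis as a parameter; it is existentially
  quantified here, so that finite-dimensionality is a property of \<open>scale\<close> alone.
\<close>

locale fd_vector_space = vector_space scale
  for scale :: "'k::field_char_0 \<Rightarrow> 'a::ab_group_add \<Rightarrow> 'a"  (infixr \<open>*s\<close> 75) +
  assumes finite_dimensional: "\<exists>B. finite_dimensional_vector_space scale B"

text \<open>The library constant \<open>bilinear\<close> is restricted to real vector spaces.\<close>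

definition bilinear_operation ::
    "('k::field \<Rightarrow> 'a::ab_group_add \<Rightarrow> 'a) \<Rightarrow> ('a \<Rightarrow> 'a \<Rightarrow> 'a) \<Rightarrow> bool" where
  "bilinear_operation scale f \<longleftrightarrow>
     (\<forall>a. Vector_Spaces.linear scale scale (\<lambda>b. f a b)) \<and>
     (\<forall>b. Vector_Spaces.linear scale scale (\<lambda>a. f a b))"

locale zinbiel_algebra = fd_vector_space scale
  for scale :: "'k::field_char_0 \<Rightarrow> 'a::ab_group_add \<Rightarrow> 'a"  (infixr \<open>*s\<close> 75) +
  fixes succ :: "'a \<Rightarrow> 'a \<Rightarrow> 'a"  (infixl \<open>\<succ>\<close> 70)
  assumes bilinear_succ: "bilinear_operation scale succ"
    and zinbiel: "a \<succ> (b \<succ> c) = (b \<succ> a + a \<succ> b) \<succ> c"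

definition derivation ::
    "('k::field \<Rightarrow> 'a::ab_group_add \<Rightarrow> 'a) \<Rightarrow> ('a \<Rightarrow> 'a \<Rightarrow> 'a) \<Rightarrow> ('a \<Rightarrow> 'a) \<Rightarrow> bool" where
  "derivation scale f D \<longleftrightarrow>
     Vector_Spaces.linear scale scale D \<and> (\<forall>a b. D (f a b) = f (D a) b + f a (D b))"

locale pre_novikov_algebra = fd_vector_space scale
  for scale :: "'k::field_char_0 \<Rightarrow> 'a::ab_group_add \<Rightarrow> 'a"  (infixr \<open>*s\<close> 75) +
  fixes lhd :: "'a \<Rightarrow> 'a \<Rightarrow> 'a"  (infixl \<open>\<lhd>\<close> 70)
    and rhd :: "'a \<Rightarrow> 'a \<Rightarrow> 'a"  (infixl \<open>\<rhd>\<close> 70)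
  assumes bilinear_lhd: "bilinear_operation scale lhd"
    and bilinear_rhd: "bilinear_operation scale rhd"
    and rhd_rhd:
      "a \<rhd> (b \<rhd> c) = (a \<rhd> b + a \<lhd> b) \<rhd> c + b \<rhd> (a \<rhd> c) - (b \<rhd> a + b \<lhd> a) \<rhd> c"
    and rhd_lhd:
      "a \<rhd> (b \<lhd> c) = (a \<rhd> b) \<lhd> c + b \<lhd> (a \<lhd> c + a \<rhd> c) - (b \<lhd> a) \<lhd> c"
    and add_rhd: "(a \<lhd> b + a \<rhd> b) \<rhd> c = (a \<rhd> c) \<lhd> b"
    and lhd_lhd: "(a \<lhd> b) \<lhd> c = (a \<lhd> c) \<lhd> b"

locale pre_differential_novikov_poisson_algebra =
  pre_novikov_algebra scale lhd rhd + zinbiel_algebra scale succ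
  for scale :: "'k::field_char_0 \<Rightarrow> 'a::ab_group_add \<Rightarrow> 'a"  (infixr \<open>*s\<close> 75)
    and lhd :: "'a \<Rightarrow> 'a \<Rightarrow> 'a"  (infixl \<open>\<lhd>\<close> 70)
    and rhd :: "'a \<Rightarrow> 'a \<Rightarrow> 'a"  (infixl \<open>\<rhd>\<close> 70)
    and succ :: "'a \<Rightarrow> 'a \<Rightarrow> 'a"  (infixl \<open>\<succ>\<close> 70) +
  assumes succ_rhd: "(a \<succ> b + b \<succ> a) \<rhd> c = a \<succ> (b \<rhd> c)"
    and succ_lhd: "(a \<succ> c) \<lhd> b = a \<succ> (c \<lhd> b)"
    and succ_lhd': "a \<succ> (c \<lhd> b) = (a \<lhd> b + a \<rhd> b) \<succ> c"
    and rhd_succ: "a \<rhd> (b \<succ> c) = (a \<lhd> b + a \<rhd> b) \<succ> c + b \<succ> (a \<rhd> c)"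
    and lhd_succ: "c \<lhd> (a \<succ> b + b \<succ> a) = b \<succ> (c \<lhd> a) + a \<succ> (c \<lhd> b)"

end

theory Submission
  imports Defs
begin

text \<open>
  The proposition rests on one observation. Write \<open>L\<^sub>a = (\<lambda>c. a \<succ> c)\<close> and
  \<open>a * b = a \<succ> b + b \<succ> a\<close>. The Zinbiel identity says that \<open>L\<^sub>a L\<^sub>b = L\<^bsub>a * b\<^esub>\<close>, and since
  \<open>*\<close> is visibly commutative, left multiplications commute with each other.
  A derivation of \<open>\<succ>\<close> is also a derivation of \<open>*\<close>.

  With \<open>a \<lhd> b = D b \<succ> a\<close> and \<open>a \<rhd> b = a \<succ> D b\<close>, the sum \<open>a \<lhd> b + a \<rhd> b\<close> is the
  commutative product \<open>a * D b\<close>. Hence, once the Leibniz rule has been applied, both sides of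
  each axiom are signed sums of terms \<open>L\<^sub>x L\<^sub>y z\<close> and \<open>L\<^bsub>x * y\<^esub> z\<close> in the elements and their
  derivatives. For instance, the first pre-Novikov identity becomes
  \<open>a \<succ> (D b \<succ> D c) + a \<succ> (b \<succ> D (D c)) =
    (a * D b) \<succ> D c + b \<succ> (D a \<succ> D c) + b \<succ> (a \<succ> D (D c)) - (b * D a) \<succ> D c\<close>,
  where the terms match in pairs or cancel. The other identities work in the same way.
\<close>

lemma linear_imp_add:
  assumes "Vector_Spaces.linear s1 s2 f"
  shows "f (x + y) = f x + f y"
proof -
  interpret Vector_Spaces.linear s1 s2 f by fact
  show ?thesis by (rule add)
qed

lemma bilinear_operation_add:
  assumes "bilinear_operation scale f"
  shows "f (a + b) c = f a c + f b c" and "f a (b + c) = f a b + f a c"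
  using assms linear_imp_add unfolding bilinear_operation_def by blast+

lemma linear_compose_fun:
  assumes "Vector_Spaces.linear s1 s2 f" and "Vector_Spaces.linear s2 s3 g"
  shows "Vector_Spaces.linear s1 s3 (\<lambda>x. g (f x))"
  using Vector_Spaces.linear_compose[OF assms] by (simp add: o_def)

lemma bilinear_operation_compose_right:
  assumes "bilinear_operation scale f" and "Vector_Spaces.linear scale scale D"
  shows "bilinear_operation scale (\<lambda>a b. f a (D b))"
  using assms unfolding bilinear_operation_def by (auto intro: linear_compose_fun)

lemma bilinear_operation_flip:
  assumes "bilinear_operation scale f"
  shows "bilinear_operation scale (\<lambda>a b. f b a)"
  using assms unfolding bilinear_operation_def by blast

theorem proposition5p17:
  fixes scale :: "'k::field_char_0 \<Rightarrow> 'a::ab_group_add \<Rightarrow> 'a"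
    and succ :: "'a \<Rightarrow> 'a \<Rightarrow> 'a"
    and D :: "'a \<Rightarrow> 'a"
  assumes "zinbiel_algebra scale succ"
    and "derivation scale succ D"
  shows "pre_differential_novikov_poisson_algebra scale
           (\<lambda>a b. succ (D b) a) (\<lambda>a b. succ a (D b)) succ"
proof -
  interpret zinbiel_algebra scale succ by fact
  have D_linear: "Vector_Spaces.linear scale scale D"
    and D_succ: "D (succ a b) = succ (D a) b + succ a (D b)" for a b
    using assms(2) unfolding derivation_def by auto
  have D_add: "D (a + b) = D a + D b" for a b
    using D_linear by (rule linear_imp_add)
  have bilinear_rhd: "bilinear_operation scale (\<lambda>a b. succ a (D b))"
    by (rule bilinear_operation_compose_right[OF bilinear_succ D_linear])
  have bilinear_lhd: "bilinear_operation scale (\<lambda>a b. succ (D b) a)"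
    by (rule bilinear_operation_compose_right[OF bilinear_operation_flip[OF bilinear_succ] D_linear])
  \<comment> \<open>Oriented from left to right, the Zinbiel identity turns every monomial into a sum of
    left-nested ones. With biadditivity and the Leibniz rule this is a terminating rewrite
    system, and the two sides of each axiom have the same normal form up to
    the laws of an abelian group.\<close>
  note normalize = zinbiel bilinear_operation_add[OF bilinear_succ] D_succ D_add
  show ?thesis
    by unfold_locales (simp_all add: bilinear_lhd bilinear_rhd normalize algebra_simps)
qed

end
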